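(* There is a sequential reading with an unbounded stack, whose state set is the set of finite reduced words in $x_1^{\pm1},\ldots,x_5^{\pm1}$, which recovers $\rho(w)$ for every $w\in\mathcal W$; that is, its value on $w$ equals the reduced word $\rho(w)$ for every $w\in\mathcal W$.
   Context: $Q_3$ is the $1$-skeleton (graph) of the three-dimensional cube, with vertex set $V=\{0,1\}^3$ and coordinates numbered $0,1,2$; two vertices are adjacent iff they differ in exactly one coordinate. A vertex is written $b_2b_1b_0$ ($b_i$ the $i$-th coordinate) and identified with the integer $4b_2+2b_1+b_0\in\{0,\ldots,7\}$. The basepoint is $o=000$. A walk is $w=(o;a_1a_2\cdots a_n)$ with $n\ge0$, $a_k\in\{0,1,2\}$; its vertex sequence is $v_0=o,v_1,\ldots,v_n$, where $v_k$ is obtained from $v_{k-1}$ by flipping coordinate $a_k$; its $k$-th directed edge is $e_k=(v_{k-1},v_k)$. It is closed if $v_n=o$. $\mathcal W$ is the monoid of based closed walks under concatenation. Reduced loop word: fix the spanning tree of $Q_3$ given by the path $000,001,011,010,110,111,101,100$ (i.e. $0,1,3,2,6,7,5,4$). The five remaining (cotree) edges $(0,2),(0,4),(1,5),(3,7),(4,6)$ are oriented from the smaller to the larger integer and denoted $x_1,\ldots,x_5$ in this order; $F_5$ is the free group on $x_1,\ldots,x_5$, whose elements are identified with reduced words. For $w\in\mathcal W$, reading the steps in order, a forward crossing of the $i$-th cotree edge contributes $x_i$, a backward crossing contributes $x_i^{-1}$, and a tree edge contributes nothing; $\rho(w)\in F_5$ is the free reduction of the resulting word. A sequential reading consists of a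 state set $S$ (finite or infinite), an initial state $s_0\in S$, update maps $T_e:S\to S$ for the directed edges $e$ of $Q_3$, a set $Y$, and an output map $q:S\to Y$. Its value on a walk with directed edge sequence $e_1,\ldots,e_n$ is $q\bigl(T_{e_n}\circ\cdots\circ T_{e_1}(s_0)\bigr)$. "With an unbounded stack" means that the state is a word (of unbounded length) used as a stack, whose top is its last letter: each update leaves the word unchanged, deletes its last letter, or appends one letter at the end, the choice depending only on the directed edge and the last letter; the stack is initially empty and the output map is the identity. *)

theory Defs
  imports Main "HOL-Library.Numeral_Type"
begin

section \<open>The cube graph and based walks\<close>

text \<open>
  The coordinates \<open>0, 1, 2\<close> are the elements of the three-element type \<^typ>\<open>3\<close>
  (in which the numeral \<open>3\<close> equals \<open>0\<close>).
\<close>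

type_synonym vertex = "3 \<Rightarrow> bool"

definition vertex_number :: "vertex \<Rightarrow> nat" where
  "vertex_number v = 4 * of_bool (v 2) + 2 * of_bool (v 1) + of_bool (v 0)"

definition directed_edges :: "(vertex \<times> vertex) set" where
  "directed_edges = {(u, v). \<exists>!a. u a \<noteq> v a}"

definition origin :: vertex where
  "origin = (\<lambda>_. False)"

definition flip :: "3 \<Rightarrow> vertex \<Rightarrow> vertex" where
  "flip a v = v(a := \<not> v a)"

text \<open>A walk \<open>(o; a\<^sub>1 \<dots> a\<^sub>n)\<close> is represented by the list \<open>[a\<^sub>1, \<dots>, a\<^sub>n]\<close>.\<close>

type_synonym walk = "3 list"

primrec edges_from :: "vertex \<Rightarrow> walk \<Rightarrow> (vertex \<times> vertex) list" where
  "edges_from v [] = []"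
| "edges_from v (a # w) = (v, flip a v) # edges_from (flip a v) w"

definition edge_sequence :: "walk \<Rightarrow> (vertex \<times> vertex) list" where
  "edge_sequence w = edges_from origin w"

definition closed_walks :: "walk set" where
  "closed_walks = {w. fold flip w origin = origin}"


section \<open>Free reduction\<close>

datatype 'a letter = Gen 'a | Inv 'a

fun inverse_letter :: "'a letter \<Rightarrow> 'a letter" where
  "inverse_letter (Gen x) = Inv x"
| "inverse_letter (Inv x) = Gen x"

definition reduced :: "'a letter list \<Rightarrow> bool" where
  "reduced w \<longleftrightarrow> (\<nexists>us a vs. w = us @ [a, inverse_letter a] @ vs)"

inductive cancels :: "'a letter list \<Rightarrow> 'a letter list \<Rightarrow> bool" where
  "cancels (us @ [a, inverse_letter a] @ vs) (us @ vs)"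

definition free_reduction :: "'a letter list \<Rightarrow> 'a letter list" where
  "free_reduction w = (THE r. reduced r \<and> cancels\<^sup>*\<^sup>* w r)"


section \<open>The reduced loop word\<close>

datatype gen = X1 | X2 | X3 | X4 | X5

definition tree_path :: "nat list" where
  "tree_path = [0, 1, 3, 2, 6, 7, 5, 4]"

definition cotree :: "((nat \<times> nat) \<times> gen) list" where
  "cotree = [((0, 2), X1), ((0, 4), X2), ((1, 5), X3), ((3, 7), X4), ((4, 6), X5)]"

text \<open>The listed cotree edges are exactly the edges of the cube outside the spanning path.\<close>

lemma cotree_complement:
  "fst ` set cotree =
     {(m, n). m < n \<and> (\<exists>(u, v) \<in> directed_edges. m = vertex_number u \<and> n = vertex_number v)}
     - (set (zip tree_path (tl tree_path)) \<union> set (zip (tl tree_path) tree_path))"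
proof -
  define N :: "bool \<Rightarrow> bool \<Rightarrow> bool \<Rightarrow> nat"
    where "N = (\<lambda>x y z. 4 * of_bool z + 2 * of_bool y + of_bool x)"
  have UNIV_3: "(UNIV :: 3 set) = {0, 1, 2}"
  proof -
    have "card {0, 1, 2 :: 3} = CARD(3)" by simp
    then show ?thesis by (metis card_subset_eq finite subset_UNIV)
  qed
  have edge_iff: "(u, v) \<in> directed_edges \<longleftrightarrow> (\<exists>a. v = flip a u)" for u v
  proof -
    have "v = flip a u \<longleftrightarrow> u a \<noteq> v a \<and> (\<forall>b. u b \<noteq> v b \<longrightarrow> b = a)" for a
      unfolding flip_def by (auto simp: fun_eq_iff)
    then show ?thesis
      unfolding directed_edges_def Ex1_def by simp
  qed
  have ex_vertex: "(\<exists>v :: vertex. P (v 0) (v 1) (v 2)) \<longleftrightarrow> (\<exists>x y z. P x y z)"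
    for P :: "bool \<Rightarrow> bool \<Rightarrow> bool \<Rightarrow> bool"
  proof
    assume "\<exists>x y z. P x y z"
    then obtain x y z where "P x y z" by blast
    moreover define v :: vertex where "v = (\<lambda>_. x)(1 := y, 2 := z)"
    ultimately have "P (v 0) (v 1) (v 2)" by simp
    then show "\<exists>v :: vertex. P (v 0) (v 1) (v 2)" by blast
  qed blast
  define E :: "(nat \<times> nat) set" where "E =
      {(0,1),(0,2),(0,4),(1,3),(1,5),(2,3),(2,6),(3,7),(4,5),(4,6),(5,7),(6,7),
       (1,0),(2,0),(4,0),(3,1),(5,1),(3,2),(6,2),(7,3),(5,4),(6,4),(7,5),(7,6)}"
  have "(\<exists>(u, v) \<in> directed_edges. m = vertex_number u \<and> n = vertex_number v) \<longleftrightarrow> (m, n) \<in> E" for m n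
  proof -
    have "(\<exists>(u, v) \<in> directed_edges. m = vertex_number u \<and> n = vertex_number v) \<longleftrightarrow>
        (\<exists>u :: vertex. \<exists>a \<in> UNIV. m = vertex_number u \<and> n = vertex_number (flip a u))"
      by (auto simp: Bex_def edge_iff)
    also have "\<dots> \<longleftrightarrow> (\<exists>u :: vertex. m = N (u 0) (u 1) (u 2) \<and>
        (n = N (\<not> u 0) (u 1) (u 2) \<or> n = N (u 0) (\<not> u 1) (u 2) \<or> n = N (u 0) (u 1) (\<not> u 2)))"
      unfolding UNIV_3 by (simp add: vertex_number_def flip_def N_def)
    also have "\<dots> \<longleftrightarrow> (\<exists>x y z. m = N x y z \<and>
        (n = N (\<not> x) y z \<or> n = N x (\<not> y) z \<or> n = N x y (\<not> z)))"
      by (rule ex_vertex)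
    also have "\<dots> \<longleftrightarrow> (m, n) \<in>
        (\<Union>x \<in> {False, True}. \<Union>y \<in> {False, True}. \<Union>z \<in> {False, True}.
          {(N x y z, N (\<not> x) y z), (N x y z, N x (\<not> y) z), (N x y z, N x y (\<not> z))})"
      unfolding UNIV_bool[symmetric] UN_iff by (simp add: conj_disj_distribL)
    also have "(\<Union>x \<in> {False, True}. \<Union>y \<in> {False, True}. \<Union>z \<in> {False, True}.
          {(N x y z, N (\<not> x) y z), (N x y z, N x (\<not> y) z), (N x y z, N x y (\<not> z))}) = E"
      unfolding N_def E_def by code_simp
    finally show ?thesis .
  qed
  then have "{(m, n). m < n \<and> (\<exists>(u, v) \<in> directed_edges. m = vertex_number u \<and> n = vertex_number v)}
      = Set.filter (\<lambda>(m, n). m < n) E"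
    by auto
  moreover have "\<dots> - (set (zip tree_path (tl tree_path)) \<union> set (zip (tl tree_path) tree_path)) = fst ` set cotree"
    unfolding E_def by code_simp
  ultimately show ?thesis by simp
qed

definition contribution :: "vertex \<times> vertex \<Rightarrow> gen letter list" where
  "contribution = (\<lambda>(u, v).
     case map_of cotree (vertex_number u, vertex_number v) of
       Some x \<Rightarrow> [Gen x]
     | None \<Rightarrow>
         (case map_of cotree (vertex_number v, vertex_number u) of
            Some x \<Rightarrow> [Inv x]
          | None \<Rightarrow> []))"

definition reduced_loop_word :: "walk \<Rightarrow> gen letter list" where
  "reduced_loop_word w = free_reduction (concat (map contribution (edge_sequence w)))"


section \<open>Sequential readings\<close>

record ('s, 'y) reading =
  states :: "'s set"
  initial :: 's
  update :: "vertex \<times> vertex \<Rightarrow> 's \<Rightarrow> 's"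
  targets :: "'y set"
  out :: "'s \<Rightarrow> 'y"

definition sequential_reading :: "('s, 'y) reading \<Rightarrow> bool" where
  "sequential_reading R \<longleftrightarrow>
     initial R \<in> states R \<and>
     (\<forall>e \<in> directed_edges. \<forall>s \<in> states R. update R e s \<in> states R) \<and>
     (\<forall>s \<in> states R. out R s \<in> targets R)"

definition reading_value :: "('s, 'y) reading \<Rightarrow> walk \<Rightarrow> 'y" where
  "reading_value R w = out R (fold (update R) (edge_sequence w) (initial R))"

datatype 'a stack_action = Keep | Pop | Push 'a

text \<open>The top of the stack is the last letter; popping the empty stack has the same effect as \<open>Keep\<close>.\<close>

fun perform :: "'a stack_action \<Rightarrow> 'a list \<Rightarrow> 'a list" where
  "perform Keep s = s"
| "perform Pop s = butlast s"
| "perform (Push a) s = s @ [a]"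

definition top_letter :: "'a list \<Rightarrow> 'a option" where
  "top_letter s = (if s = [] then None else Some (last s))"

definition with_unbounded_stack :: "('a list, 'a list) reading \<Rightarrow> bool" where
  "with_unbounded_stack R \<longleftrightarrow>
     initial R = [] \<and>
     (\<exists>choice :: vertex \<times> vertex \<Rightarrow> 'a option \<Rightarrow> 'a stack_action.
        \<forall>e \<in> directed_edges. \<forall>s \<in> states R.
          update R e s = perform (choice e (top_letter s)) s) \<and>
     targets R = states R \<and>
     (\<forall>s \<in> states R. out R s = s)"

end

theory Submission
  imports Defs
begin

text \<open>
  The stack holds the free reduction of the word read so far. When a letter \<open>a\<close> arrives, it cancels
  against the top of the stack if that top is \<open>a\<inverse>\<close>, and is pushed otherwise (\<open>absorb\<close>). This
  single-letter rule maps reduced words to reduced words, and on reduced words absorbing \<open>a\<close> and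
  then \<open>a\<inverse>\<close> has no effect (\<open>absorb_inverse_cancel\<close>). Absorbing all letters of a word is therefore
  invariant under cancellation of adjacent inverse letters, and it fixes reduced words; since its
  result can itself be reached by cancellations, it is the unique reduced form of the word
  (\<open>free_reduction_eq_fold_absorb\<close>). A directed edge contributes at most one letter, so each edge
  costs at most one stack operation, determined by the edge and the top letter.
\<close>

lemma inverse_letter_inverse [simp]: "inverse_letter (inverse_letter a) = a"
  by (cases a) simp_all

lemma reduced_Nil [simp]: "reduced []"
  by (simp add: reduced_def)

lemma reduced_appendD: "reduced (s @ t) \<Longrightarrow> reduced s"
  unfolding reduced_def by (metis append.assoc)

lemma reduced_butlast: "reduced s \<Longrightarrow> reduced (butlast s)"
  by (cases s rule: rev_cases) (auto dest: reduced_appendD)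

lemma reduced_snoc_iff:
  "reduced (s @ [a]) \<longleftrightarrow> reduced s \<and> top_letter s \<noteq> Some (inverse_letter a)"
proof (intro iffI conjI notI)
  assume "reduced (s @ [a])"
  then show "reduced s" by (rule reduced_appendD)
next
  assume red: "reduced (s @ [a])" and "top_letter s = Some (inverse_letter a)"
  then obtain t where "s = t @ [inverse_letter a]"
    by (cases s rule: rev_cases) (auto simp: top_letter_def)
  then have "s @ [a] = t @ [inverse_letter a, inverse_letter (inverse_letter a)] @ []" by simp
  with red show False unfolding reduced_def by blast
next
  assume *: "reduced s \<and> top_letter s \<noteq> Some (inverse_letter a)"
  show "reduced (s @ [a])"
    unfolding reduced_def
  proof (intro notI, elim exE)
    fix us b vs
    assume eq: "s @ [a] = us @ [b, inverse_letter b] @ vs"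
    show False
    proof (cases vs rule: rev_cases)
      case Nil
      with eq have "s = us @ [b]" "a = inverse_letter b" by simp_all
      with * show False by (simp add: top_letter_def)
    next
      case (snoc vs' c)
      with eq have "s = us @ [b, inverse_letter b] @ vs'" by simp
      with * show False unfolding reduced_def by blast
    qed
  qed
qed

text \<open>Right multiplication of a reduced word by one letter, as a stack operation.\<close>

definition absorb :: "'a letter \<Rightarrow> 'a letter list \<Rightarrow> 'a letter list" where
  "absorb a s = (if top_letter s = Some (inverse_letter a) then butlast s else s @ [a])"

lemma reduced_absorb: "reduced s \<Longrightarrow> reduced (absorb a s)"
  by (simp add: absorb_def reduced_butlast reduced_snoc_iff)

lemma reduced_fold_absorb: "reduced s \<Longrightarrow> reduced (fold absorb w s)"
  by (induction w arbitrary: s) (simp_all add: reduced_absorb)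

lemma absorb_inverse_cancel:
  assumes "reduced s"
  shows "absorb (inverse_letter a) (absorb a s) = s"
proof (cases "top_letter s = Some (inverse_letter a)")
  case True
  then obtain t where t: "s = t @ [inverse_letter a]"
    by (cases s rule: rev_cases) (auto simp: top_letter_def)
  \<comment> \<open>Reducedness of \<open>s\<close> keeps the letter below the popped one from being \<open>a\<close>, so \<open>a\<inverse>\<close> is pushed back.\<close>
  with assms have "top_letter t \<noteq> Some a" by (simp add: reduced_snoc_iff)
  with True t show ?thesis by (simp add: absorb_def)
next
  case False
  then show ?thesis by (simp add: absorb_def) (simp add: top_letter_def)
qed

lemma fold_absorb_cancels:
  assumes "cancels w w'" and "reduced s"
  shows "fold absorb w s = fold absorb w' s"
  using assms
  by (induction rule: cancels.induct) (simp add: absorb_inverse_cancel reduced_fold_absorb)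

lemma fold_absorb_rtranclp_cancels:
  assumes "cancels\<^sup>*\<^sup>* w w'" and "reduced s"
  shows "fold absorb w s = fold absorb w' s"
  using assms by (induction rule: rtranclp_induct) (simp_all add: fold_absorb_cancels)

lemma fold_absorb_reduced_append: "reduced (s @ w) \<Longrightarrow> fold absorb w s = s @ w"
proof (induction w arbitrary: s)
  case (Cons a w)
  then have "reduced ((s @ [a]) @ w)" by simp
  moreover from this have "absorb a s = s @ [a]"
    by (metis absorb_def reduced_appendD reduced_snoc_iff)
  ultimately show ?case using Cons.IH by fastforce
qed simp

lemma cancels_fold_absorb: "cancels\<^sup>*\<^sup>* (s @ w) (fold absorb w s)"
proof (induction w arbitrary: s)
  case (Cons a w)
  have "cancels\<^sup>*\<^sup>* (s @ a # w) (absorb a s @ w)"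
  proof (cases "top_letter s = Some (inverse_letter a)")
    case True
    then obtain t where t: "s = t @ [inverse_letter a]"
      by (cases s rule: rev_cases) (auto simp: top_letter_def)
    with cancels.intros[of t "inverse_letter a" w] True show ?thesis
      by (simp add: absorb_def r_into_rtranclp)
  qed (simp add: absorb_def)
  with Cons.IH[of "absorb a s"] show ?case by simp
qed simp

lemma free_reduction_eq_fold_absorb: "free_reduction w = fold absorb w []"
  unfolding free_reduction_def
proof (rule the_equality)
  show "reduced (fold absorb w []) \<and> cancels\<^sup>*\<^sup>* w (fold absorb w [])"
    using cancels_fold_absorb[of "[]" w] by (simp add: reduced_fold_absorb)
next
  fix r
  assume "reduced r \<and> cancels\<^sup>*\<^sup>* w r"
  then show "r = fold absorb w []"
    using fold_absorb_rtranclp_cancels[of w r "[]"] fold_absorb_reduced_append[of "[]" r] by simp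
qed

lemma contribution_cases:
  obtains "contribution e = []" | a where "contribution e = [a]"
proof -
  have "contribution e = [] \<or> (\<exists>a. contribution e = [a])"
    by (cases e) (simp add: contribution_def split: option.split)
  with that show thesis by blast
qed

lemma fold_fold_concat_map: "fold (\<lambda>e. fold f (g e)) es s = fold f (concat (map g es)) s"
  by (induction es arbitrary: s) simp_all

text \<open>The stack operation performed on a directed edge, given the top letter of the stack.\<close>

definition edge_action :: "vertex \<times> vertex \<Rightarrow> gen letter option \<Rightarrow> gen letter stack_action" where
  "edge_action e t = (case contribution e of
     [] \<Rightarrow> Keep
   | a # _ \<Rightarrow> if t = Some (inverse_letter a) then Pop else Push a)"

lemma perform_edge_action:
  "perform (edge_action e (top_letter s)) s = fold absorb (contribution e) s"
  by (cases e rule: contribution_cases) (simp_all add: edge_action_def absorb_def)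

theorem theorem5p3:
  shows "\<exists>R :: (gen letter list, gen letter list) reading.
     sequential_reading R \<and> with_unbounded_stack R \<and>
     states R = {s. reduced s} \<and>
     (\<forall>w \<in> closed_walks. reading_value R w = reduced_loop_word w)"
proof -
  define R :: "(gen letter list, gen letter list) reading" where
    "R = \<lparr>states = {s. reduced s}, initial = [], update = (\<lambda>e. fold absorb (contribution e)),
          targets = {s. reduced s}, out = id\<rparr>"
  have "sequential_reading R"
    by (simp add: R_def sequential_reading_def reduced_fold_absorb)
  moreover have "with_unbounded_stack R"
    unfolding with_unbounded_stack_def
    by (auto simp: R_def perform_edge_action intro!: exI[of _ edge_action])
  moreover have "states R = {s. reduced s}"
    by (simp add: R_def)
  moreover have "reading_value R w = reduced_loop_word w" for w
    by (simp add: R_def reading_value_def reduced_loop_word_def free_reduction_eq_fold_absorb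
        fold_fold_concat_map)
  ultimately show ?thesis by blast
qed

end
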